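(* There exist absolute constants $c,C>0$ such that for all integers $r\ge 2$ and $s$ with $1\le s\le \sqrt r$ there is $n_0=n_0(r,s)$ such that for all $n\ge n_0$, $$c\cdot\frac{s^2}{r}\cdot n\;\le\; f(n,r,s)\;\le\; C\cdot \frac{s^2}{r}\log r\cdot n .$$ (In the paper's notation: for $1\le s\le\sqrt r$ and $n$ large enough, $f(n,r,s)=\widetilde{\Theta}_r(s^2/r)\cdot n$.)
   Context: An $r$-edge colouring of $K_n$ assigns to each edge one of $r$ colours. $f(n,r,s)$ denotes the largest integer $m$ such that in every $r$-edge colouring of $K_n$ there exist a set $S$ of at most $s$ colours and a connected subgraph of $K_n$ on at least $m$ vertices all of whose edges have colours in $S$. Logarithms are base $2$. The notation $F=\widetilde{\Theta}_r(G)$ means $F=\Omega(G)$ and $F\le O(G)\cdot\log r$. *)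

theory Defs
  imports Complex_Main "Graph_Theory.Digraph_Component"
begin

text \<open>
  Undirected graphs are the symmetric digraphs of \<^locale>\<open>graph\<close>: an edge \<open>{u, v}\<close> is the pair of
  arcs \<open>(u, v)\<close> and \<open>(v, u)\<close>.
\<close>

definition complete_graph :: "nat \<Rightarrow> nat pair_pre_digraph" where
  "complete_graph n = \<lparr> pverts = {..<n}, parcs = {(u, v). u < n \<and> v < n \<and> u \<noteq> v} \<rparr>"

text \<open>
  A colouring takes the two-element set \<open>{u, v}\<close> as its argument, so both arcs of an edge have the
  same colour. The colours are \<open>0, \<dots>, r - 1\<close>, and not all of them need to occur. Values of \<open>\<chi>\<close> on
  sets that are not edges are irrelevant.
\<close>

definition edge_colouring :: "nat \<Rightarrow> nat \<Rightarrow> (nat set \<Rightarrow> nat) \<Rightarrow> bool" where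
  "edge_colouring n r \<chi> \<longleftrightarrow>
     (\<forall>e \<in> arcs (with_proj (complete_graph n)). \<chi> {fst e, snd e} \<in> {..<r})"

definition connected_in_colours ::
  "nat \<Rightarrow> (nat set \<Rightarrow> nat) \<Rightarrow> nat set \<Rightarrow> (nat, nat \<times> nat) pre_digraph \<Rightarrow> bool" where
  "connected_in_colours n \<chi> S H \<longleftrightarrow>
     graph H \<and> subgraph H (with_proj (complete_graph n)) \<and> Digraph_Component.connected H \<and>
     (\<forall>e \<in> arcs H. \<chi> {fst e, snd e} \<in> S)"

text \<open>
  The function \<open>f(n, r, s)\<close>. For \<open>n = 0\<close> no subgraph is connected, as the library excludes the null graph, and the value is
  unspecified. For \<open>n, r \<ge> 1\<close> the greatest element exists, by the lemma that follows.
\<close>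

definition connected_number :: "nat \<Rightarrow> nat \<Rightarrow> nat \<Rightarrow> nat" where
  "connected_number n r s = (GREATEST m. \<forall>\<chi>. edge_colouring n r \<chi> \<longrightarrow>
     (\<exists>S H. S \<subseteq> {..<r} \<and> card S \<le> s \<and> connected_in_colours n \<chi> S H \<and> m \<le> card (verts H)))"

lemma connected_number_ge_iff:
  assumes "n \<ge> 1" "r \<ge> 1"
  shows "m \<le> connected_number n r s \<longleftrightarrow> (\<forall>\<chi>. edge_colouring n r \<chi> \<longrightarrow>
     (\<exists>S H. S \<subseteq> {..<r} \<and> card S \<le> s \<and> connected_in_colours n \<chi> S H \<and> m \<le> card (verts H)))"
    (is "_ \<longleftrightarrow> ?P m")
proof -
  let ?H = "with_proj \<lparr> pverts = {0::nat}, parcs = {} \<rparr>"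
  have g: "graph ?H"
    by unfold_locales (auto simp: symmetric_def arcs_ends_def sym_def)
  have w: "wf_digraph (with_proj (complete_graph n))"
    by unfold_locales (auto simp: complete_graph_def)
  have sub: "subgraph ?H (with_proj (complete_graph n))"
    using assms w g graph.axioms(1)[OF g]
    by (auto simp: subgraph_def compatible_def complete_graph_def wf_digraph_def)
  have con: "Digraph_Component.connected ?H"
    by (auto simp: Digraph_Component.connected_def strongly_connected_def mk_symmetric_def
        reachable_def)
  have P1: "?P 1"
    using g sub con
    by (intro allI impI exI[of _ "{}"] exI[of _ ?H]) (auto simp: connected_in_colours_def)
  have bound: "y \<le> n" if "?P y" for y
  proof -
    have "edge_colouring n r (\<lambda>_. 0)" using assms by (auto simp: edge_colouring_def)
    with that obtain S H where "connected_in_colours n (\<lambda>_. 0) S H" "y \<le> card (verts H)"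
      by blast
    moreover from this have "verts H \<subseteq> {..<n}"
      by (auto simp: connected_in_colours_def subgraph_def complete_graph_def)
    ultimately show ?thesis
      using card_mono[of "{..<n}" "verts H"] by simp
  qed
  have "?P (connected_number n r s)"
    unfolding connected_number_def by (rule GreatestI_nat[of ?P, OF P1]) (use bound in blast)
  moreover have "y \<le> connected_number n r s" if "?P y" for y
    unfolding connected_number_def by (rule Greatest_le_nat[of ?P, OF that]) (use bound in blast)
  ultimately show ?thesis by (meson order_trans)
qed

end

theory Submission
  imports Defs "HOL-Library.FuncSet"
begin

text \<open>
  Lower bound. Put \<open>m = s n / r\<close>. Merge monochromatic stars, each with at least \<open>m\<close> new vertices, into one
  connected set \<open>A\<close>, at a cost of two colours per star (its own colour and that of an edge to its centre). If \<open>s/2\<close> stars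
  can be merged, or \<open>A\<close> fills half of the vertices, we are done. Otherwise every vertex outside \<open>A\<close>
  has degree less than \<open>m\<close> outside \<open>A\<close> in each colour, so its degrees are spread over
  the colours, and \<open>s/2\<close> greedily chosen colours give a constant fraction of the vertices
  a degree of order \<open>m\<close>. These vertices lie in components of order \<open>m\<close>; since the graph is
  complete, each further colour joins one more of them.

  Upper bound. Take a uniformly random colouring of the complete graph on \<open>N = r div (9 s)\<close> vertices. A component with more
  than \<open>k\<close> vertices in \<open>s\<close> colours contains \<open>k + 1\<close> vertices spanning \<open>k\<close> edges in these
  colours, and by a union bound this has probability less than one for \<open>k\<close> of order
  \<open>s log r\<close>. Blowing up each vertex into \<open>n / N\<close> vertices gives components of at most
  about \<open>k n / N\<close> vertices.
\<close>

subsection \<open>Components in a set of colours\<close>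

definition adj :: "nat \<Rightarrow> (nat set \<Rightarrow> nat) \<Rightarrow> nat set \<Rightarrow> nat rel" where
  "adj n \<chi> S = {(x, y). x < n \<and> y < n \<and> x \<noteq> y \<and> \<chi> {x, y} \<in> S}"

text \<open>All size estimates are made for these reachability sets, not for subgraphs. For
  \<open>v\<close> at least \<open>n\<close> the set is just \<open>{v}\<close>, which is why bounds
  on its size ask for \<open>v < n\<close>.\<close>

definition component :: "nat \<Rightarrow> (nat set \<Rightarrow> nat) \<Rightarrow> nat set \<Rightarrow> nat \<Rightarrow> nat set" where
  "component n \<chi> S v = (adj n \<chi> S)\<^sup>* `` {v}"

lemma edge_colouring_iff:
  "edge_colouring n r \<chi> \<longleftrightarrow> (\<forall>x < n. \<forall>y < n. x \<noteq> y \<longrightarrow> \<chi> {x, y} < r)"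
  by (auto simp: edge_colouring_def complete_graph_def)

lemma sym_adj: "sym (adj n \<chi> S)"
  by (auto simp: adj_def sym_def insert_commute)

lemma adj_mono: "S \<subseteq> S' \<Longrightarrow> adj n \<chi> S \<subseteq> adj n \<chi> S'"
  by (auto simp: adj_def)

lemma component_mono: "S \<subseteq> S' \<Longrightarrow> component n \<chi> S v \<subseteq> component n \<chi> S' v"
  unfolding component_def using rtrancl_mono[OF adj_mono] by blast

lemma self_in_component [simp]: "v \<in> component n \<chi> S v"
  by (simp add: component_def)

lemma component_subset: "v < n \<Longrightarrow> component n \<chi> S v \<subseteq> {..<n}"
proof
  fix w assume "v < n" "w \<in> component n \<chi> S v"
  then have "(v, w) \<in> (adj n \<chi> S)\<^sup>*" by (simp add: component_def)
  then show "w \<in> {..<n}" using \<open>v < n\<close> by induction (auto simp: adj_def)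
qed

lemma finite_component: "v < n \<Longrightarrow> finite (component n \<chi> S v)"
  using finite_subset[OF component_subset] by simp

lemma component_eq: "w \<in> component n \<chi> S v \<Longrightarrow> component n \<chi> S w = component n \<chi> S v"
  unfolding component_def using symD[OF sym_rtrancl[OF sym_adj], of v w n \<chi> S]
  by (auto intro: rtrancl_trans)

lemma components_disjoint:
  "w \<notin> component n \<chi> S v \<Longrightarrow> component n \<chi> S w \<inter> component n \<chi> S v = {}"
  using component_eq self_in_component by blast

lemma adj_in_component:
  "w \<in> component n \<chi> S v \<Longrightarrow> (w, x) \<in> adj n \<chi> S \<Longrightarrow> x \<in> component n \<chi> S v"
  by (auto simp: component_def)

text \<open>Completeness pays here: any two vertices span an edge, so its single colour is enough to
  unite their components. Both greedy merging arguments rest on this.\<close>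

lemma component_join:
  assumes "u < n" "v < n" "u \<noteq> v"
  shows "component n \<chi> S u \<union> component n \<chi> S v \<subseteq> component n \<chi> (insert (\<chi> {u, v}) S) u"
proof -
  have "v \<in> component n \<chi> (insert (\<chi> {u, v}) S) u"
    using assms by (intro adj_in_component[OF self_in_component]) (auto simp: adj_def)
  from component_eq[OF this] show ?thesis
    using component_mono[of S "insert (\<chi> {u, v}) S"] by blast
qed

section \<open>Components as maximal connected subgraphs\<close>

lemma connected_in_colours_component:
  assumes "v < n"
  obtains H where "connected_in_colours n \<chi> S H" "verts H = component n \<chi> S v"
proof -
  define K where "K = component n \<chi> S v"
  \<comment> \<open>The subgraph carries every edge of the permitted colours inside
    \<open>K\<close>, so a path from \<open>v\<close> in \<open>adj\<close> never leaves it.\<close>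
  define H where "H = with_proj \<lparr> pverts = K, parcs = adj n \<chi> S \<inter> K \<times> K \<rparr>"
  have Kn: "K \<subseteq> {..<n}" unfolding K_def by (rule component_subset[OF assms])
  have fin: "finite K" using Kn finite_subset by blast
  have g: "graph H"
    unfolding H_def using fin
    by unfold_locales (auto simp: adj_def symmetric_def arcs_ends_def arc_to_ends_def
        sym_def insert_commute)
  have w: "wf_digraph (with_proj (complete_graph n))"
    by unfold_locales (auto simp: complete_graph_def)
  interpret graph H by (rule g)
  have sub: "subgraph H (with_proj (complete_graph n))"
    unfolding subgraph_def
  proof (intro conjI w wf_digraph_axioms)
    show "verts H \<subseteq> verts (with_proj (complete_graph n))"
      using Kn by (simp add: H_def complete_graph_def)
    show "arcs H \<subseteq> arcs (with_proj (complete_graph n))"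
      by (auto simp: H_def complete_graph_def adj_def)
    show "compatible (with_proj (complete_graph n)) H"
      by (simp add: H_def compatible_def)
  qed
  have reach: "v \<rightarrow>\<^sup>*\<^bsub>H\<^esub> w" if "(v, w) \<in> (adj n \<chi> S)\<^sup>*" for w
    using that
  proof induction
    case base
    have "v \<in> verts H" by (auto simp: H_def K_def)
    then show ?case by (rule reachable_refl)
  next
    case (step y z)
    have "y \<in> K" "z \<in> K" using step.hyps by (auto simp: K_def component_def)
    then have "y \<rightarrow>\<^bsub>H\<^esub> z" using step.hyps by (auto simp: H_def arcs_ends_def arc_to_ends_def)
    then show ?case using step.IH by (meson reachable_adj_trans)
  qed
  have "strongly_connected H"
  proof (rule strongly_connectedI)
    show "verts H \<noteq> {}" using self_in_component[of v n \<chi> S] by (auto simp: H_def K_def simp del: self_in_component)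
    fix x y assume "x \<in> verts H" "y \<in> verts H"
    then have "v \<rightarrow>\<^sup>*\<^bsub>H\<^esub> x" "v \<rightarrow>\<^sup>*\<^bsub>H\<^esub> y" using reach by (auto simp: H_def K_def component_def)
    then show "x \<rightarrow>\<^sup>*\<^bsub>H\<^esub> y"
      by (meson reachable_trans symmetric_reachable sym_arcs)
  qed
  then have "Digraph_Component.connected H" 
    using sym_arcs by (auto simp: Digraph_Component.connected_def strongly_connected_def reachable_mk_symmetric_eq)
  with g sub have "connected_in_colours n \<chi> S H"
    by (auto simp: connected_in_colours_def H_def adj_def)
  then show ?thesis using that by (simp add: H_def K_def)
qed

text \<open>Every walk in \<open>H\<close> is a walk in \<open>adj\<close>. With the preceding lemma
  this shows that the largest connected subgraph in the colours \<open>S\<close> has the size of the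
  largest component.\<close>

lemma verts_subset_component:
  assumes "connected_in_colours n \<chi> S H" "v \<in> verts H"
  shows "verts H \<subseteq> component n \<chi> S v"
proof
  fix w assume "w \<in> verts H"
  interpret graph H using assms by (simp add: connected_in_colours_def)
  have sub: "subgraph H (with_proj (complete_graph n))" and
    S: "\<And>e. e \<in> arcs H \<Longrightarrow> \<chi> {fst e, snd e} \<in> S" and con: "Digraph_Component.connected H"
    using assms by (auto simp: connected_in_colours_def)
  have "strongly_connected H"
    using con sym_arcs by (rule symmetric_connected_imp_strongly_connected[rotated])
  then have "v \<rightarrow>\<^sup>*\<^bsub>H\<^esub> w" using assms(2) \<open>w \<in> verts H\<close> by (auto simp: strongly_connected_def)
  then show "w \<in> component n \<chi> S v"
  proof (induction rule: reachable_induct)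
    case (step x y)
    then obtain e where e: "e \<in> arcs H" "tail H e = x" "head H e = y" by auto
    then have "e \<in> arcs (with_proj (complete_graph n))" "x = fst e" "y = snd e"
      using sub by (auto simp: subgraph_def compatible_def)
    then have "(x, y) \<in> adj n \<chi> S" using S[OF e(1)]
      by (auto simp: adj_def complete_graph_def)
    with step show ?case by (blast intro: adj_in_component)
  qed simp
qed

subsection \<open>Large components in every colouring\<close>

text \<open>Induction on \<open>k\<close>. As long as the last alternative fails, some vertex
  outside the component is the centre of a monochromatic star with at least \<open>m\<close> leaves
  outside it; the colour of the star and that of the edge from \<open>u\<close> to its centre absorb
  these leaves.\<close>

lemma greedy_stars:
  fixes m :: real
  assumes col: "edge_colouring n r \<chi>" and "n \<ge> 1"
  shows "\<exists>S u. S \<subseteq> {..<r} \<and> card S \<le> 2 * k \<and> u < n \<and>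
    (k * m \<le> card (component n \<chi> S u) \<or>
     (\<forall>v \<in> {..<n} - component n \<chi> S u. \<forall>i < r.
        card {w \<in> {..<n} - component n \<chi> S u. w \<noteq> v \<and> \<chi> {v, w} = i} < m))"
proof (induction k)
  case 0
  show ?case using \<open>n \<ge> 1\<close> by (intro exI[of _ "{}"] exI[of _ 0]) auto
next
  case (Suc k)
  then obtain S u where IH: "S \<subseteq> {..<r}" "card S \<le> 2 * k" "u < n"
    "k * m \<le> card (component n \<chi> S u) \<or>
     (\<forall>v \<in> {..<n} - component n \<chi> S u. \<forall>i < r.
        card {w \<in> {..<n} - component n \<chi> S u. w \<noteq> v \<and> \<chi> {v, w} = i} < m)" (is "_ \<or> ?stop")
    by blast
  show ?case
  proof (cases ?stop)
    case True
    with IH show ?thesis by (intro exI[of _ S] exI[of _ u]) auto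
  next
    case False
    define A where "A = component n \<chi> S u"
    from False obtain v i where vi: "v < n" "v \<notin> A" "i < r"
      "m \<le> card {w \<in> {..<n} - A. w \<noteq> v \<and> \<chi> {v, w} = i}"
      unfolding A_def by (auto simp: not_less)
    define N where "N = {w \<in> {..<n} - A. w \<noteq> v \<and> \<chi> {v, w} = i}"
    define S' where "S' = insert (\<chi> {u, v}) (insert i S)"
    have uv: "u \<noteq> v" using vi by (auto simp: A_def)
    have "N \<subseteq> component n \<chi> (insert i S) v"
      using vi by (auto simp: N_def adj_def intro!: adj_in_component[OF self_in_component])
    moreover have "A \<subseteq> component n \<chi> (insert i S) u"
      unfolding A_def by (rule component_mono) auto
    ultimately have AN: "A \<union> N \<subseteq> component n \<chi> S' u"
      unfolding S'_def using component_join[OF IH(3) vi(1) uv] by blast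
    have kA: "k * m \<le> card A" using IH(4) False unfolding A_def by blast
    have "k * m + m \<le> card A + card N"
      using kA vi(4) by (simp add: N_def)
    also have "\<dots> = card (A \<union> N)"
      using finite_component[OF IH(3)] by (subst card_Un_disjoint) (auto simp: N_def A_def)
    also have "\<dots> \<le> card (component n \<chi> S' u)"
      using AN card_mono[OF finite_component[OF IH(3)]] by simp
    finally have "Suc k * m \<le> card (component n \<chi> S' u)" by (simp add: algebra_simps)
    moreover have "S' \<subseteq> {..<r}"
      using IH vi uv col by (auto simp: S'_def edge_colouring_iff)
    moreover have "card S' \<le> 2 * Suc k"
      using IH(2) card_insert_le_m1[of _ "insert i S"]
        finite_subset[OF IH(1)] by (auto simp: S'_def card_insert_if)
    ultimately show ?thesis using IH(3) by (intro exI[of _ S'] exI[of _ u]) blast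
  qed
qed

text \<open>
  The potential \<open>\<Sum>v\<in>W. min (\<Sum>i\<in>T. d i v) (M + \<tau>)\<close> is capped so that a large value forces
  many vertices to reach \<open>\<tau>\<close>, while adding a colour to a vertex below \<open>\<tau>\<close> never hits the cap.
\<close>

lemma greedy_colours:
  fixes d :: "nat \<Rightarrow> 'a \<Rightarrow> real" and M N \<tau> :: real
  assumes "finite W" "r > 0" "\<tau> \<ge> 0"
    and d0: "\<And>i v. v \<in> W \<Longrightarrow> i < r \<Longrightarrow> 0 \<le> d i v"
    and dM: "\<And>i v. v \<in> W \<Longrightarrow> i < r \<Longrightarrow> d i v \<le> M"
    and dN: "\<And>v. v \<in> W \<Longrightarrow> (\<Sum>i<r. d i v) = N"
  shows "\<exists>T. T \<subseteq> {..<r} \<and> card T \<le> t \<and>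
    (card W \<le> 2 * card {v \<in> W. \<tau> \<le> (\<Sum>i\<in>T. d i v)} \<or>
     t * ((N - \<tau>) * card W / (2 * real r)) \<le> (\<Sum>v\<in>W. min (\<Sum>i\<in>T. d i v) (M + \<tau>)))"
proof (induction t)
  case 0
  \<comment> \<open>The cap is nonnegative: colour 0 exists because \<open>r > 0\<close>, and its
    degrees lie between 0 and \<open>M\<close>.\<close>
  have "0 \<le> min 0 (M + \<tau>)" if "v \<in> W" for v
    using d0[OF that \<open>r > 0\<close>] dM[OF that \<open>r > 0\<close>] \<open>\<tau> \<ge> 0\<close> by linarith
  then have "0 \<le> (\<Sum>v\<in>W. min 0 (M + \<tau>))"
    by (rule sum_nonneg)
  then show ?case by (intro exI[of _ "{}"]) simp
next
  case (Suc t)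
  let ?sat = "\<lambda>T. {v \<in> W. \<tau> \<le> (\<Sum>i\<in>T. d i v)}"
  define \<Phi> where "\<Phi> = (\<lambda>T. \<Sum>v\<in>W. min (\<Sum>i\<in>T. d i v) (M + \<tau>))"
  define g where "g = (N - \<tau>) * card W / (2 * real r)"
  have "\<exists>T \<subseteq> {..<r}. card T \<le> t \<and> (card W \<le> 2 * card (?sat T) \<or> t * g \<le> \<Phi> T)"
    using Suc unfolding \<Phi>_def g_def .
  then obtain T where T: "T \<subseteq> {..<r}" "card T \<le> t"
    "card W \<le> 2 * card (?sat T) \<or> t * g \<le> \<Phi> T" by (elim exE conjE)
  have finT: "finite T" using T finite_subset by blast
  show ?case
  proof (cases "card W \<le> 2 * card (?sat T)")
    case True
    with T show ?thesis by (intro exI[of _ T]) auto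
  next
    case False
    let ?U = "W - ?sat T"
    have U: "card W \<le> 2 * card ?U"
      using False \<open>finite W\<close> by (subst card_Diff_subset) auto
    have gain0: "min (\<Sum>j\<in>T. d j v) (M + \<tau>) \<le> min (\<Sum>j\<in>insert i T. d j v) (M + \<tau>)"
      if "v \<in> W" "i < r" for i v
      using d0[OF that] finT by (auto simp: sum.insert_if min_def)
    \<comment> \<open>A vertex of \<open>?U\<close> has sum below \<tau>, and one further colour
      adds at most \<open>M\<close>, so the cap is inactive before and after and the gain is
      exact.\<close>
    have gain: "min (\<Sum>j\<in>insert i T. d j v) (M + \<tau>) - min (\<Sum>j\<in>T. d j v) (M + \<tau>) =
        (if i \<in> T then 0 else d i v)" if "v \<in> ?U" "i < r" for i v
      using that d0[of v i] dM[of v i] finT by (auto simp: sum.insert_if min_def insert_absorb)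
    \<comment> \<open>If \<open>N < \<tau>\<close> the required gain is not positive, and
      monotonicity of the potential suffices.\<close>
    have "r * g \<le> (N - \<tau>) * card ?U \<or> N < \<tau>"
    proof (cases "N < \<tau>")
      case False
      then have "(N - \<tau>) * card W \<le> (N - \<tau>) * (2 * card ?U)"
        using U by (intro mult_left_mono) (auto simp flip: of_nat_mult)
      then show ?thesis using \<open>r > 0\<close> by (auto simp: g_def)
    qed simp
    moreover have "r * g \<le> 0" if "N < \<tau>"
      using that by (auto simp: g_def mult_nonpos_nonneg)
    moreover have "0 \<le> (\<Sum>i<r. \<Phi> (insert i T) - \<Phi> T)"
      unfolding \<Phi>_def using gain0 by (intro sum_nonneg) (auto intro!: sum_mono)
    \<comment> \<open>An unsaturated vertex has used less than \<tau> of its total degree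
      \<open>N\<close>, so the colours outside \<open>T\<close> still offer it at least
      \<open>N - \<tau>\<close>.\<close>
    moreover have "(N - \<tau>) * card ?U \<le> (\<Sum>i<r. \<Phi> (insert i T) - \<Phi> T)"
    proof -
      have "(N - \<tau>) * card ?U = (\<Sum>v\<in>?U. N - \<tau>)" by simp
      also have "\<dots> \<le> (\<Sum>v\<in>?U. \<Sum>i\<in>{..<r} - T. d i v)"
        using T(1) dN by (intro sum_mono) (auto simp: sum_diff)
      also have "\<dots> = (\<Sum>v\<in>?U. \<Sum>i<r. if i \<in> T then 0 else d i v)"
        by (intro sum.cong sum.mono_neutral_cong_left) auto
      also have "\<dots> = (\<Sum>v\<in>?U. \<Sum>i<r.
          min (\<Sum>j\<in>insert i T. d j v) (M + \<tau>) - min (\<Sum>j\<in>T. d j v) (M + \<tau>))"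
        using gain by (intro sum.cong refl) auto
      also have "\<dots> = (\<Sum>i<r. \<Sum>v\<in>?U.
          min (\<Sum>j\<in>insert i T. d j v) (M + \<tau>) - min (\<Sum>j\<in>T. d j v) (M + \<tau>))"
        by (rule sum.swap)
      also have "\<dots> \<le> (\<Sum>i<r. \<Sum>v\<in>W.
          min (\<Sum>j\<in>insert i T. d j v) (M + \<tau>) - min (\<Sum>j\<in>T. d j v) (M + \<tau>))"
        using \<open>finite W\<close> gain0 by (intro sum_mono sum_mono2) auto
      also have "\<dots> = (\<Sum>i<r. \<Phi> (insert i T) - \<Phi> T)"
        by (simp add: \<Phi>_def sum_subtractf)
      finally show ?thesis .
    qed
    ultimately have "(\<Sum>i<r. g) \<le> (\<Sum>i<r. \<Phi> (insert i T) - \<Phi> T)"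
      by auto
    \<comment> \<open>Averaging over all \<open>r\<close> colours: not every one can gain less than
      \<open>g\<close>.\<close>
    then have "\<not> (\<forall>i\<in>{..<r}. \<Phi> (insert i T) - \<Phi> T < g)"
      using sum_strict_mono[of "{..<r}" "\<lambda>i. \<Phi> (insert i T) - \<Phi> T" "\<lambda>_. g"] \<open>r > 0\<close>
      by fastforce
    then obtain i where i: "i < r" "g \<le> \<Phi> (insert i T) - \<Phi> T" by (auto simp: not_less)
    have "Suc t * g \<le> \<Phi> (insert i T)"
      using T(3) False i by (simp add: algebra_simps)
    moreover have "insert i T \<subseteq> {..<r}" "card (insert i T) \<le> Suc t"
      using T i finT by (auto simp: card_insert_if)
    ultimately show ?thesis unfolding \<Phi>_def g_def by (intro exI[of _ "insert i T"] conjI disjI2)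
  qed
qed

text \<open>A vertex of \<open>B\<close> not yet reached lies in a different component for
  \<open>S\<close>, which is disjoint from the current one and, as \<open>S\<close> contains
  \<open>T\<close>, still has at least \<tau> vertices. One colour joins the two.\<close>

lemma greedy_merge:
  fixes \<tau> :: real
  assumes col: "edge_colouring n r \<chi>" and T: "T \<subseteq> {..<r}" and B: "B \<subseteq> {..<n}"
    and n: "n \<ge> 1" and \<tau>: "\<And>b. b \<in> B \<Longrightarrow> \<tau> \<le> card (component n \<chi> T b)"
  shows "\<exists>S u. T \<subseteq> S \<and> S \<subseteq> {..<r} \<and> card S \<le> card T + k \<and> u < n \<and>
    (k * \<tau> \<le> card (component n \<chi> S u) \<or> B \<subseteq> component n \<chi> S u)"
proof (induction k)
  case 0
  show ?case using n T by (intro exI[of _ T] exI[of _ 0]) auto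
next
  case (Suc k)
  then obtain S u where IH: "T \<subseteq> S" "S \<subseteq> {..<r}" "card S \<le> card T + k" "u < n"
    "k * \<tau> \<le> card (component n \<chi> S u) \<or> B \<subseteq> component n \<chi> S u" by blast
  show ?case
  proof (cases "B \<subseteq> component n \<chi> S u")
    case True
    with IH show ?thesis by (intro exI[of _ S] exI[of _ u]) auto
  next
    case False
    then obtain b where b: "b \<in> B" "b \<notin> component n \<chi> S u" by blast
    have bn: "b < n" and ub: "u \<noteq> b" using b B by auto
    define S' where "S' = insert (\<chi> {u, b}) S"
    have "k * \<tau> + \<tau> \<le> card (component n \<chi> S u) + card (component n \<chi> T b)"
      using IH(5) False \<tau>[OF b(1)] by simp
    also have "\<dots> \<le> card (component n \<chi> S u) + card (component n \<chi> S b)"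
      using card_mono[OF finite_component[OF bn] component_mono[OF IH(1)]] by simp
    also have "\<dots> = card (component n \<chi> S u \<union> component n \<chi> S b)"
      using components_disjoint[OF b(2)] finite_component[OF IH(4)] finite_component[OF bn]
      by (subst card_Un_disjoint) auto
    also have "\<dots> \<le> card (component n \<chi> S' u)"
      using component_join[OF IH(4) bn ub] card_mono[OF finite_component[OF IH(4)]]
      by (simp add: S'_def)
    finally have "Suc k * \<tau> \<le> card (component n \<chi> S' u)" by (simp add: algebra_simps)
    moreover have "S' \<subseteq> {..<r}"
      using IH bn ub col by (auto simp: S'_def edge_colouring_iff)
    moreover have "card S' \<le> card T + Suc k"
      using IH(3) finite_subset[OF IH(2)] by (auto simp: S'_def card_insert_if)
    moreover have "T \<subseteq> S'" using IH(1) by (auto simp: S'_def)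
    ultimately show ?thesis using IH(4) by (intro exI[of _ S'] exI[of _ u] conjI disjI1)
  qed
qed

section \<open>From the greedy steps to a large component\<close>

lemma sum_card_colour_neighbours:
  assumes "finite W" "finite T"
  shows "(\<Sum>i\<in>T. card {w \<in> W. w \<noteq> v \<and> \<chi> {v, w} = i}) = card {w \<in> W. w \<noteq> v \<and> \<chi> {v, w} \<in> T}"
proof -
  have "{w \<in> W. w \<noteq> v \<and> \<chi> {v, w} \<in> T} = (\<Union>i\<in>T. {w \<in> W. w \<noteq> v \<and> \<chi> {v, w} = i})" by auto
  also have "card \<dots> = (\<Sum>i\<in>T. card {w \<in> W. w \<noteq> v \<and> \<chi> {v, w} = i})"
    using assms by (intro card_UN_disjoint) auto
  finally show ?thesis ..
qed

text \<open>Pigeonhole on the star at vertex 0. Counting the centre once in each colour, the stars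
  have total size \<open>n - 1 + r\<close>, which is at least \<open>n\<close>.\<close>

lemma large_component_one_colour:
  assumes col: "edge_colouring n r \<chi>" and "r \<ge> 1" "n \<ge> 1"
  shows "\<exists>i < r. real n / r \<le> card (component n \<chi> {i} 0)"
proof (rule ccontr)
  let ?N = "\<lambda>i. {w \<in> {..<n}. w \<noteq> 0 \<and> \<chi> {0, w} = i}"
  assume "\<not> ?thesis"
  then have less: "real (card (component n \<chi> {i} 0)) < real n / r" if "i < r" for i
    using that by (auto simp: not_le)
  have star: "card (?N i) + 1 \<le> card (component n \<chi> {i} 0)" for i
  proof -
    have "insert 0 (?N i) \<subseteq> component n \<chi> {i} 0"
      using \<open>n \<ge> 1\<close> by (auto simp: adj_def intro!: adj_in_component[OF self_in_component])
    then have "card (insert 0 (?N i)) \<le> card (component n \<chi> {i} 0)"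
      using \<open>n \<ge> 1\<close> by (intro card_mono finite_component) auto
    then show ?thesis by (simp add: card_insert_if)
  qed
  have "real (card (?N i)) + 1 < real n / r" if "i < r" for i
    using less[OF that] star[of i] by linarith
  then have "(\<Sum>i<r. real (card (?N i)) + 1) < (\<Sum>i<r. real n / r)"
    using \<open>r \<ge> 1\<close> by (intro sum_strict_mono) (auto simp: lessThan_empty_iff)
  moreover have "(\<Sum>i<r. real (card (?N i))) = real n - 1"
  proof -
    have "{w \<in> {..<n}. w \<noteq> 0 \<and> \<chi> {0, w} \<in> {..<r}} = {..<n} - {0}"
      using col \<open>n \<ge> 1\<close> by (auto simp: edge_colouring_iff)
    then have "(\<Sum>i<r. card (?N i)) = card ({..<n} - {0})"
      using sum_card_colour_neighbours[of "{..<n}" "{..<r}" 0 \<chi>] by (simp only: finite_lessThan)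
    also have "\<dots> = n - 1" using \<open>n \<ge> 1\<close> by simp
    finally show ?thesis using \<open>n \<ge> 1\<close> by (simp only: of_nat_sum[symmetric] of_nat_diff)
  qed
  moreover have "(\<Sum>i<r. real n / r) = n" using \<open>r \<ge> 1\<close> by simp
  moreover have "real r \<ge> 1" using \<open>r \<ge> 1\<close> by simp
  ultimately show False by (simp only: sum.distrib) simp
qed

text \<open>The stars may use \<open>2 * q\<close> colours. If they fail, their colours are
  discarded and only the set \<open>W\<close> is kept; then \<open>q\<close> colours create
  components of size at least \<tau> and \<open>q\<close> more merge them. Both ways cost at most
  \<open>s\<close>.\<close>

lemma large_component:
  assumes col: "edge_colouring n r \<chi>" and s: "s \<ge> 2" "s\<^sup>2 \<le> r" and n: "n \<ge> 4"
  shows "\<exists>S u. S \<subseteq> {..<r} \<and> card S \<le> s \<and> u < n \<and>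
    (real s)\<^sup>2 / r * n / 300 \<le> card (component n \<chi> S u)"
proof -
  define q where "q = s div 2"
  \<comment> \<open>The star size is \<open>\<rho> * n\<close>, the target is of order
    \<open>\<sigma> * n\<close>, and \<kappa> is the share of all colours that \<open>q\<close> of
    them make up.\<close>
  define \<kappa> where "\<kappa> = real q / r"
  define \<rho> where "\<rho> = real s / r"
  define \<sigma> where "\<sigma> = (real s)\<^sup>2 / r"
  have r: "r > 0" and n1: "n \<ge> 1" and "s \<le> r" using s n by (auto simp: power2_eq_square intro: order_trans[OF _ s(2)] Nat.gr0I)
  have q: "2 * q \<le> s" "s \<le> 3 * q" using s by (auto simp: q_def)
  have "real s / 3 / r \<le> \<kappa>" "\<kappa> \<le> real s / 2 / r"
    unfolding \<kappa>_def using q by (intro divide_right_mono; simp)+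
  then have \<rho>: "0 < \<rho>" "\<rho> / 3 \<le> \<kappa>" "\<kappa> \<le> \<rho> / 2" "\<rho> \<le> 1"
    "\<kappa> \<le> 1" "0 \<le> \<kappa>"
    using s r q \<open>s \<le> r\<close> by (auto simp: \<rho>_def \<kappa>_def)
  have \<sigma>: "\<sigma> = s * \<rho>" "0 < \<sigma>" "\<sigma> \<le> 1"
    using s r by (auto simp: \<sigma>_def \<rho>_def power2_eq_square simp flip: of_nat_mult)
  have \<sigma>n: "\<sigma> * n \<le> n" using \<sigma> by (simp add: mult_left_le_one_le)
  have \<sigma>n0: "0 \<le> \<sigma> * n" using \<sigma>(2) by simp
  obtain S u where S: "S \<subseteq> {..<r}" "card S \<le> 2 * q" "u < n"
    "q * (\<rho> * n) \<le> card (component n \<chi> S u) \<or>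
     (\<forall>v \<in> {..<n} - component n \<chi> S u. \<forall>i < r.
        card {w \<in> {..<n} - component n \<chi> S u. w \<noteq> v \<and> \<chi> {v, w} = i} < \<rho> * n)"
    using greedy_stars[OF col n1, of q "\<rho> * n"] by blast
  define W where "W = {..<n} - component n \<chi> S u"
  define d where "d = (\<lambda>i v. real (card {w \<in> W. w \<noteq> v \<and> \<chi> {v, w} = i}))"
  have "finite W" by (simp add: W_def)
  consider "q * (\<rho> * n) \<le> card (component n \<chi> S u)" | "n \<le> 2 * card (component n \<chi> S u)"
    | "2 * card (component n \<chi> S u) < n" "\<And>v i. v \<in> W \<Longrightarrow> i < r \<Longrightarrow> d i v < \<rho> * n"
    using S(4) unfolding W_def d_def by fastforce
  then have "\<exists>S u. S \<subseteq> {..<r} \<and> card S \<le> s \<and> u < n \<and> \<sigma> * n / 300 \<le> card (component n \<chi> S u)"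
  proof cases
    case 1
    have "\<sigma> * n / 3 = s / 3 * (\<rho> * n)" using \<sigma> by simp
    also have "\<dots> \<le> q * (\<rho> * n)" using q \<rho> by (intro mult_right_mono) auto
    finally have "\<sigma> * n / 300 \<le> card (component n \<chi> S u)" using \<sigma>n0 1 by linarith
    with S q show ?thesis by (intro exI[of _ S] exI[of _ u]) auto
  next
    case 2
    then have "\<sigma> * n / 300 \<le> card (component n \<chi> S u)" using \<sigma>n by linarith
    with S q show ?thesis by (intro exI[of _ S] exI[of _ u]) auto
  next
    case 3
    define N where "N = real (card W) - 1"
    \<comment> \<open>On average \<open>q\<close> colours give a vertex degree
      \<open>\<kappa> * N\<close> inside \<open>W\<close>; the threshold asks for one eighth of
      it.\<close>
    define \<tau> where "\<tau> = \<kappa> * N / 8"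
    have "card W + card (component n \<chi> S u) = n"
      using component_subset[OF S(3), of \<chi> S] finite_component[OF S(3)]
      unfolding W_def by (subst card_Diff_subset) (auto dest: card_mono[rotated])
    then have W: "real n / 2 \<le> card W" "card W \<le> n" using 3(1) by linarith+
    \<comment> \<open>\<open>n >= 4\<close> absorbs the loss of one vertex: \<open>n / 2 - 1\<close>
      is at least \<open>n / 4\<close>.\<close>
    then have N: "real n / 4 \<le> N" "N \<le> n" using n unfolding N_def by linarith+
    have \<tau>: "0 \<le> \<tau>" "\<tau> \<le> N / 8" "\<tau> \<le> \<rho> * n / 16"
    proof -
      show "0 \<le> \<tau>" using N \<rho> by (simp add: \<tau>_def)
      have "\<kappa> * N \<le> 1 * N" using \<rho> N by (intro mult_right_mono) auto
      then show "\<tau> \<le> N / 8" by (simp add: \<tau>_def)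
      have "\<kappa> * N \<le> \<rho> / 2 * n" using \<rho> N by (intro mult_mono) auto
      then show "\<tau> \<le> \<rho> * n / 16" unfolding \<tau>_def by linarith
    qed
    have sumd: "(\<Sum>i\<in>T. d i v) = card {w \<in> W. w \<noteq> v \<and> \<chi> {v, w} \<in> T}" if "T \<subseteq> {..<r}" for T v
      using sum_card_colour_neighbours[OF \<open>finite W\<close> finite_subset[OF that]]
      by (simp add: d_def flip: of_nat_sum)
    have dN: "(\<Sum>i<r. d i v) = N" if "v \<in> W" for v
    proof -
      have "{w \<in> W. w \<noteq> v \<and> \<chi> {v, w} \<in> {..<r}} = W - {v}"
        using col that by (auto simp: edge_colouring_iff W_def)
      moreover have "1 \<le> card W" using that \<open>finite W\<close> by (auto simp: Suc_le_eq card_gt_0_iff)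
      ultimately show ?thesis using that by (simp add: sumd N_def of_nat_diff)
    qed
    obtain T where T: "T \<subseteq> {..<r}" "card T \<le> q"
      "card W \<le> 2 * card {v \<in> W. \<tau> \<le> (\<Sum>i\<in>T. d i v)} \<or>
       q * ((N - \<tau>) * card W / (2 * real r)) \<le> (\<Sum>v\<in>W. min (\<Sum>i\<in>T. d i v) (\<rho> * n + \<tau>))"
      using greedy_colours[of W r \<tau> d "\<rho> * n" N q] \<open>finite W\<close> r \<tau>(1) 3(2)[THEN less_imp_le] dN
      unfolding d_def by (metis (no_types, lifting) of_nat_0_le_iff)
    define B where "B = {v \<in> W. \<tau> \<le> (\<Sum>i\<in>T. d i v)}"
    have B: "n / 100 \<le> card B"
    proof (cases "card W \<le> 2 * card B")
      case True
      with W show ?thesis by linarith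
    next
      case False
      \<comment> \<open>Vertices outside \<open>B\<close> contribute less than \<tau> each, so most
        of the potential must come from \<open>B\<close>, where the cap bounds each contribution.
        Hence \<open>B\<close> is large.\<close>
      have "(\<Sum>v\<in>W. min (\<Sum>i\<in>T. d i v) (\<rho> * n + \<tau>)) \<le>
          (\<Sum>v\<in>W. \<tau> + (if v \<in> B then \<rho> * n + \<tau> else 0))"
        using \<tau>(1) by (intro sum_mono) (auto simp: B_def)
      also have "\<dots> = card W * \<tau> + card B * (\<rho> * n + \<tau>)"
        using \<open>finite W\<close> by (simp add: sum.distrib B_def flip: sum.inter_filter)
      finally have le: "q * ((N - \<tau>) * card W / (2 * real r)) \<le> card W * \<tau> + card B * (\<rho> * n + \<tau>)"
        using T(3) False unfolding B_def by linarith
      define P where "P = \<kappa> * (N * card W)"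
      have "P * (7 / 16) = \<kappa> * (card W / 2) * (7 / 8 * N)" by (simp add: P_def)
      also have "\<dots> \<le> \<kappa> * (card W / 2) * (N - \<tau>)"
        using \<tau>(2) \<rho> by (intro mult_left_mono) auto
      also have "\<dots> = q * ((N - \<tau>) * card W / (2 * real r))" by (simp add: \<kappa>_def mult_ac)
      also note le
      also have "card W * \<tau> = P / 8" by (simp add: P_def \<tau>_def)
      finally have "P * (5 / 16) \<le> card B * (\<rho> * n + \<tau>)" by simp
      also have "\<dots> \<le> card B * (\<rho> * n * (17 / 16))"
        using \<tau>(3) by (intro mult_left_mono) auto
      finally have le2: "P * (5 / 16) \<le> card B * (\<rho> * n * (17 / 16))" .
      \<comment> \<open>With \<open>P\<close> of order \<open>\<rho> * n^2\<close>, the bound gives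
        at least \<open>5 * n / 408\<close> vertices in \<open>B\<close>, more than
        \<open>n / 100\<close>.\<close>
      have "\<rho> / 3 * (n / 4 * (n / 2)) \<le> P"
        unfolding P_def using \<rho> W N by (intro mult_mono) auto
      with le2 have "\<rho> * n * (n / 24 * (5 / 16)) \<le> \<rho> * n * (card B * (17 / 16))"
        by (simp add: algebra_simps)
      then have "n / 24 * (5 / 16) \<le> card B * (17 / 16)"
        using \<rho>(1) n by (subst (asm) mult_le_cancel_left_pos) auto
      then show ?thesis by simp
    qed
    have Bn: "B \<subseteq> {..<n}" by (auto simp: B_def W_def)
    have B\<tau>: "\<tau> \<le> card (component n \<chi> T b)" if "b \<in> B" for b
    proof -
      have b: "b < n" using that by (auto simp: B_def W_def)
      have "{w \<in> W. w \<noteq> b \<and> \<chi> {b, w} \<in> T} \<subseteq> component n \<chi> T b"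
        using b by (auto simp: adj_def W_def intro!: adj_in_component[OF self_in_component])
      then have "real (card {w \<in> W. w \<noteq> b \<and> \<chi> {b, w} \<in> T}) \<le> card (component n \<chi> T b)"
        using card_mono[OF finite_component[OF b]] by simp
      with that show ?thesis unfolding B_def sumd[OF T(1)] by simp
    qed
    obtain S' u' where S': "S' \<subseteq> {..<r}" "card S' \<le> card T + q" "u' < n"
      "q * \<tau> \<le> card (component n \<chi> S' u') \<or> B \<subseteq> component n \<chi> S' u'"
      using greedy_merge[OF col T(1) Bn n1 B\<tau>, of q] by blast
    have "\<sigma> * n / 300 \<le> card (component n \<chi> S' u')"
    proof (cases "B \<subseteq> component n \<chi> S' u'")
      case True
      then have "card B \<le> card (component n \<chi> S' u')"
        by (rule card_mono[OF finite_component[OF S'(3)]])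
      then show ?thesis using \<sigma>n B by linarith
    next
      case False
      \<comment> \<open>The losses \<open>3 * 3 * 4 * 8 = 288\<close> come from
        \<open>q >= s / 3\<close>, \<open>\<kappa> >= \<rho> / 3\<close>, \<open>N >= n / 4\<close>
        and the eighth in \<tau>.\<close>
      have "\<sigma> * n / 288 = s / 3 * (\<rho> / 3 * (n / 4) / 8)" using \<sigma> by simp
      also have "\<dots> \<le> q * \<tau>" unfolding \<tau>_def
        using q \<rho> N by (intro mult_mono divide_right_mono) auto
      finally show ?thesis using False S'(4) \<sigma>n0 by linarith
    qed
    with S' T(2) q show ?thesis by (intro exI[of _ S'] exI[of _ u']) auto
  qed
  then show ?thesis by (simp add: \<sigma>_def)
qed

subsection \<open>A random colouring\<close>

lemma power_le_fact: "real k ^ k \<le> 3 ^ k * fact k"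
proof -
  \<comment> \<open>A crude Stirling bound: the term of index \<open>k\<close> in the series of
    \<open>exp k\<close> is at most the whole sum.\<close>
  have "(\<Sum>j\<in>{k}. real k ^ j /\<^sub>R fact j) \<le> (\<Sum>j. real k ^ j /\<^sub>R fact j)"
    by (rule sum_le_suminf[OF summable_exp_generic]) auto
  also have "\<dots> = exp (real k)" by (simp add: exp_def)
  also have "\<dots> = exp 1 ^ k" by (simp flip: exp_of_nat_mult)
  also have "\<dots> \<le> 3 ^ k" by (rule power_mono[OF exp_le]) simp
  finally show ?thesis by (simp add: field_simps)
qed

text \<open>The left side counts \<open>k + 1\<close> vertices with \<open>k\<close> pairs among
  them. Both factorials in the denominator are bounded by \<open>power_le_fact\<close>, after which
  all powers of \<open>k + 1\<close> cancel. The spare factor \<open>Suc k\<close> later yields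
  strictness.\<close>

lemma binomial_product_le:
  "real (N choose Suc k) * real ((Suc k choose 2) choose k) * Suc k \<le> 9 * real N * (9 * real N / 2) ^ k"
proof -
  define K where "K = real (Suc k)"
  define F where "F = (fact (Suc k) :: real)"
  define a where "a = real (N choose Suc k)"
  define b where "b = real ((Suc k choose 2) choose k)"
  have K: "K > 0" and F: "F > 0" by (simp_all add: K_def F_def)
  have Ff: "F = K * fact k" by (simp add: K_def F_def)
  have a: "a * F \<le> real N ^ Suc k"
    unfolding a_def F_def of_nat_fact[symmetric, where 'a = real] of_nat_mult[symmetric] of_nat_power[symmetric]
      of_nat_le_iff by (rule binomial_fact_pow)
  have "b * fact k \<le> real (Suc k choose 2) ^ k"
    unfolding b_def of_nat_fact[symmetric, where 'a = real] of_nat_mult[symmetric] of_nat_power[symmetric]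
      of_nat_le_iff by (rule binomial_fact_pow)
  also have "\<dots> \<le> (K\<^sup>2 / 2) ^ k"
  proof (rule power_mono)
    have "2 * (Suc k choose 2) \<le> Suc k * Suc k" by (simp add: choose_two)
    then have "real (2 * (Suc k choose 2)) \<le> real (Suc k * Suc k)" by (simp only: of_nat_le_iff)
    then have "2 * real (Suc k choose 2) \<le> K * K" unfolding of_nat_mult K_def[symmetric] by simp
    then show "real (Suc k choose 2) \<le> K\<^sup>2 / 2" by (simp add: power2_eq_square)
  qed simp
  finally have b: "b * fact k \<le> (K\<^sup>2 / 2) ^ k" .
  have K2: "K ^ (2 * Suc k) \<le> 9 ^ Suc k * F\<^sup>2"
  proof -
    have "K ^ Suc k \<le> 3 ^ Suc k * F" using power_le_fact[of "Suc k"] unfolding K_def F_def .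
    then have "(K ^ Suc k)\<^sup>2 \<le> (3 ^ Suc k * F)\<^sup>2" using K by (intro power_mono) auto
    moreover have "(3 ^ Suc k)\<^sup>2 = (9 :: real) ^ Suc k" by (simp flip: power_mult_distrib add: power2_eq_square)
    ultimately show ?thesis by (simp only: power_mult_distrib power_even_eq)
  qed
  \<comment> \<open>Multiplying by \<open>F^2\<close> and \<open>K ^ (2 * Suc k)\<close> avoids
    division; both are positive and cancel at the end.\<close>
  have "(a * b * K) * F\<^sup>2 * K ^ (2 * Suc k) = (a * F) * (b * fact k) * K\<^sup>2 * K ^ (2 * Suc k)"
    unfolding Ff by (simp add: power2_eq_square)
  also have "\<dots> \<le> real N ^ Suc k * (K\<^sup>2 / 2) ^ k * K\<^sup>2 * (9 ^ Suc k * F\<^sup>2)"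
    using a b K2 K F by (intro mult_mono) (auto simp: a_def b_def F_def)
  also have "\<dots> = (9 * real N * (9 * real N / 2) ^ k) * F\<^sup>2 * K ^ (2 * Suc k)"
    by (simp add: power_mult_distrib power_divide power_mult[symmetric] power_add mult_2
        power2_eq_square)
  finally show ?thesis using K F unfolding a_def b_def K_def[symmetric]
    by (simp add: mult_le_cancel_right)
qed

text \<open>Grow from \<open>v\<close>: while \<open>A\<close> is smaller than the component, some
  edge in the colours \<open>S\<close> leaves it. The edges form a tree, but only their number
  enters the union bound.\<close>

lemma component_contains_tree:
  assumes "v < n" "k < card (component n \<chi> S v)"
  shows "\<exists>A F. v \<in> A \<and> A \<subseteq> component n \<chi> S v \<and> card A = Suc k \<and>
    F \<subseteq> {e. e \<subseteq> A \<and> card e = 2} \<and> card F = k \<and> (\<forall>e\<in>F. \<chi> e \<in> S)"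
  using assms(2)
proof (induction k)
  case 0
  show ?case by (intro exI[of _ "{v}"] exI[of _ "{}"]) auto
next
  case (Suc k)
  then obtain A F where A: "v \<in> A" "A \<subseteq> component n \<chi> S v" "card A = Suc k"
    and F: "F \<subseteq> {e. e \<subseteq> A \<and> card e = 2}" "card F = k" "\<forall>e\<in>F. \<chi> e \<in> S"
    by (meson Suc_lessD)
  have finA: "finite A" using A(3) card_ge_0_finite by force
  have "F \<subseteq> Pow A" using F(1) by auto
  then have finF: "finite F" by (rule finite_subset) (simp add: finA)
  have "\<exists>x\<in>A. \<exists>y. y \<notin> A \<and> (x, y) \<in> adj n \<chi> S"
  proof (rule ccontr)
    assume closed: "\<not> ?thesis"
    have "w \<in> A" if "(v, w) \<in> (adj n \<chi> S)\<^sup>*" for w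
      using that by induction (use A(1) closed in blast)+
    then have "component n \<chi> S v \<subseteq> A" by (auto simp: component_def)
    then show False using Suc.prems A(3) card_mono[OF finA, of "component n \<chi> S v"] by simp
  qed
  then obtain x y where xy: "x \<in> A" "y \<notin> A" "(x, y) \<in> adj n \<chi> S" by blast
  have "{x, y} \<notin> F" using F(1) xy by auto
  then have "card (insert {x, y} F) = Suc k" using F(2) finF by simp
  moreover have "insert {x, y} F \<subseteq> {e. e \<subseteq> insert y A \<and> card e = 2}"
    using F(1) xy by (auto simp: adj_def)
  moreover have "insert y A \<subseteq> component n \<chi> S v"
    using A(2) xy adj_in_component by blast
  moreover have "card (insert y A) = Suc (Suc k)" using A(3) finA xy by simp
  moreover have "\<forall>e\<in>insert {x, y} F. \<chi> e \<in> S" using F(3) xy by (auto simp: adj_def)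
  ultimately show ?case using A(1) by (intro exI[of _ "insert y A"] exI[of _ "insert {x, y} F"]) auto
qed

text \<open>The union bound in counting form: for fixed \<open>S\<close>, \<open>A\<close>,
  \<open>F\<close>, a fraction \<open>(s / r)^k\<close> of all colourings puts \<open>F\<close> into
  \<open>S\<close>, and the hypothesis says that these fractions add up to less than one.\<close>

lemma colouring_by_counting:
  assumes count: "(r choose s) * (N choose Suc k) * ((Suc k choose 2) choose k) * s ^ k < r ^ k"
    and "s \<le> r" "r \<ge> 1"
  shows "\<exists>\<chi>. (\<forall>e. e \<subseteq> {..<N} \<and> card e = 2 \<longrightarrow> \<chi> e < r) \<and>
    (\<forall>S A F. S \<subseteq> {..<r} \<and> card S = s \<and> A \<subseteq> {..<N} \<and> card A = Suc k \<and>
       F \<subseteq> {e. e \<subseteq> A \<and> card e = 2} \<and> card F = k \<longrightarrow> (\<exists>e\<in>F. \<chi> e \<notin> S))"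
proof -
  define E where "E = {e :: nat set. e \<subseteq> {..<N} \<and> card e = 2}"
  define \<Omega> where "\<Omega> = (E \<rightarrow>\<^sub>E {..<r})"
  define I where "I = (SIGMA S:{S. S \<subseteq> {..<r} \<and> card S = s}. SIGMA A:{A. A \<subseteq> {..<N} \<and> card A = Suc k}.
    {F. F \<subseteq> {e. e \<subseteq> A \<and> card e = 2} \<and> card F = k})"
  \<comment> \<open>The bad event: edges of \<open>F\<close> are confined to \<open>S\<close>, all
    others are free.\<close>
  define X where "X = (\<lambda>(S, A :: nat set, F). \<Pi>\<^sub>E e\<in>E. if e \<in> F then S else {..<r})"
  have finE: "finite E" unfolding E_def by (rule finite_subset[of _ "Pow {..<N}"]) auto
  have fin: "finite {F. F \<subseteq> {e. e \<subseteq> A \<and> card e = 2} \<and> card F = k}"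
    and cardF: "card {F. F \<subseteq> {e. e \<subseteq> A \<and> card e = 2} \<and> card F = k} = (Suc k choose 2) choose k"
    if "A \<subseteq> {..<N}" "card A = Suc k" for A :: "nat set"
  proof -
    have A: "finite A" using that finite_subset by blast
    then have P: "finite {e. e \<subseteq> A \<and> card e = 2}"
      by (auto intro: finite_subset[of _ "Pow A"])
    show "finite {F. F \<subseteq> {e. e \<subseteq> A \<and> card e = 2} \<and> card F = k}"
      by (rule finite_subset[of _ "Pow {e. e \<subseteq> A \<and> card e = 2}"]) (use P in auto)
    show "card {F. F \<subseteq> {e. e \<subseteq> A \<and> card e = 2} \<and> card F = k} = (Suc k choose 2) choose k"
      using n_subsets[OF P] n_subsets[OF A] that by simp
  qed
  have finA: "finite {A. A \<subseteq> {..<N} \<and> card A = Suc k}"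
    by (rule finite_subset[of _ "Pow {..<N}"]) auto
  have finS: "finite {S. S \<subseteq> {..<r} \<and> card S = s}"
    by (rule finite_subset[of _ "Pow {..<r}"]) auto
  have finI: "finite I" unfolding I_def by (intro finite_SigmaI finA finS fin) auto
  have cardI: "card I = (r choose s) * ((N choose Suc k) * ((Suc k choose 2) choose k))"
  proof -
    have "card (SIGMA A:{A. A \<subseteq> {..<N} \<and> card A = Suc k}.
        {F. F \<subseteq> {e. e \<subseteq> A \<and> card e = 2} \<and> card F = k}) =
        (\<Sum>A | A \<subseteq> {..<N} \<and> card A = Suc k. (Suc k choose 2) choose k)"
      using fin cardF by (subst card_SigmaI[OF finA]) (auto intro!: sum.cong)
    also have "\<dots> = (N choose Suc k) * ((Suc k choose 2) choose k)"
      using n_subsets[of "{..<N}" "Suc k"] by simp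
    finally show ?thesis
      unfolding I_def using n_subsets[of "{..<r}" s] finA finS fin
      by (subst card_SigmaI) (auto intro!: finite_SigmaI)
  qed
  \<comment> \<open>Multiplying by \<open>r ^ k\<close> keeps the count free of subtraction in
    exponents.\<close>
  have X: "card (X i) * r ^ k = s ^ k * r ^ card E" if "i \<in> I" for i
  proof -
    obtain S A F where i: "i = (S, A, F)" by (metis surj_pair)
    have F: "F \<subseteq> E" "card F = k" "card S = s" using that by (auto simp: i I_def E_def)
    then have Fk: "E \<inter> F = F" and kE: "card (E - F) = card E - k" "k \<le> card E"
      using finE card_mono[OF finE F(1)] by (auto simp: card_Diff_subset finite_subset[OF F(1)])
    have "card (X i) = (\<Prod>e\<in>E. if e \<in> F then s else r)"
      using F finE by (simp add: X_def i card_PiE if_distrib cong: if_cong)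
    also have "\<dots> = s ^ k * r ^ (card E - k)"
      using F(2) kE finE Fk by (simp add: prod.If_cases Diff_eq)
    finally show ?thesis using kE(2) by (simp flip: power_add)
  qed
  have "card (\<Union>i\<in>I. X i) * r ^ k \<le> (\<Sum>i\<in>I. card (X i)) * r ^ k"
    by (intro mult_right_mono card_UN_le finI) simp
  also have "\<dots> = card I * (s ^ k * r ^ card E)"
    using X by (simp add: sum_distrib_right)
  also have "\<dots> < r ^ k * r ^ card E"
    using count \<open>r \<ge> 1\<close> by (simp add: cardI mult.assoc[symmetric])
  also have "\<dots> = card \<Omega> * r ^ k" by (simp add: \<Omega>_def card_PiE finE)
  finally have "card (\<Union>i\<in>I. X i) < card \<Omega>" by simp
  moreover have "finite \<Omega>" unfolding \<Omega>_def using finE by (intro finite_PiE) auto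
  moreover have "(\<Union>i\<in>I. X i) \<subseteq> \<Omega>"
    by (fastforce simp: X_def I_def \<Omega>_def PiE_iff split: if_splits)
  ultimately obtain \<chi> where \<chi>: "\<chi> \<in> \<Omega>" "\<chi> \<notin> (\<Union>i\<in>I. X i)"
    by (metis less_irrefl subset_antisym subsetI)
  have "\<exists>e\<in>F. \<chi> e \<notin> S" if "S \<subseteq> {..<r} \<and> card S = s \<and> A \<subseteq> {..<N} \<and> card A = Suc k \<and>
      F \<subseteq> {e. e \<subseteq> A \<and> card e = 2} \<and> card F = k" for S A F
  proof (rule ccontr)
    assume "\<not> ?thesis"
    then have "\<chi> \<in> X (S, A, F)" using \<chi>(1) by (auto simp: X_def \<Omega>_def PiE_iff)
    moreover have "(S, A, F) \<in> I" using that by (simp add: I_def)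
    ultimately show False using \<chi>(2) by blast
  qed
  moreover have "\<chi> e < r" if "e \<subseteq> {..<N}" "card e = 2" for e
    using \<chi>(1) that by (auto simp: \<Omega>_def E_def PiE_iff)
  ultimately show ?thesis by (intro exI[of _ \<chi>]) blast
qed

subsection \<open>Blowing up\<close>

text \<open>The blown-up vertices are the residue classes modulo \<open>N\<close>. Edges inside a
  class get the default colour 0, which is harmless because they join no two classes.\<close>

definition blow_up :: "nat \<Rightarrow> (nat set \<Rightarrow> nat) \<Rightarrow> nat set \<Rightarrow> nat" where
  "blow_up N \<chi> e = (let e' = (\<lambda>x. x mod N) ` e in if card e' = 2 then \<chi> e' else 0)"

lemma edge_colouring_blow_up:
  assumes "\<And>e. e \<subseteq> {..<N} \<Longrightarrow> card e = 2 \<Longrightarrow> \<chi> e < r" "N \<ge> 1" "r \<ge> 1"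
  shows "edge_colouring n r (blow_up N \<chi>)"
  using assms by (auto simp: edge_colouring_iff blow_up_def Let_def)

text \<open>Reduction modulo \<open>N\<close> maps a path to a path: an edge inside a class
  collapses, any other keeps its colour.\<close>

lemma component_blow_up:
  assumes "w \<in> component n (blow_up N \<chi>) S v" "N \<ge> 1"
  shows "w mod N \<in> component N \<chi> S (v mod N)"
proof -
  have "(v, w) \<in> (adj n (blow_up N \<chi>) S)\<^sup>*" using assms by (simp add: component_def)
  then show ?thesis
  proof induction
    case (step x y)
    then show ?case
    proof (cases "x mod N = y mod N")
      case False
      then have "(x mod N, y mod N) \<in> adj N \<chi> S"
        using step.hyps(2) \<open>N \<ge> 1\<close> by (auto simp: adj_def blow_up_def Let_def)
      with step.IH show ?thesis by (rule adj_in_component)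
    qed simp
  qed simp
qed

lemma card_residue_class_le: "card {x. x < n \<and> x mod N = a} \<le> n div N + (1 :: nat)"
proof -
  have "inj_on (\<lambda>x. x div N) {x. x < n \<and> x mod N = a}"
    by (rule inj_onI) (metis (mono_tags, lifting) mem_Collect_eq div_mult_mod_eq)
  moreover have "(\<lambda>x. x div N) ` {x. x < n \<and> x mod N = a} \<subseteq> {..n div N}"
    by (auto intro: div_le_mono)
  ultimately have "card {x. x < n \<and> x mod N = a} \<le> card {..n div N}"
    by (intro card_inj_on_le) auto
  then show ?thesis by simp
qed

lemma card_component_blow_up:
  assumes "v < n" "N \<ge> 1"
  shows "card (component n (blow_up N \<chi>) S v) \<le> card (component N \<chi> S (v mod N)) * (n div N + 1)"
proof -
  let ?C = "component N \<chi> S (v mod N)"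
  have "component n (blow_up N \<chi>) S v \<subseteq> (\<Union>a\<in>?C. {x. x < n \<and> x mod N = a})"
    using component_blow_up[OF _ \<open>N \<ge> 1\<close>] component_subset[OF \<open>v < n\<close>] by fast
  moreover have fin: "finite ?C" using assms by (intro finite_component) simp
  ultimately have "card (component n (blow_up N \<chi>) S v) \<le> card (\<Union>a\<in>?C. {x. x < n \<and> x mod N = a})"
    by (intro card_mono) auto
  also have "\<dots> \<le> (\<Sum>a\<in>?C. card {x. x < n \<and> x mod N = a})" by (rule card_UN_le[OF fin])
  also have "\<dots> \<le> (\<Sum>a\<in>?C. n div N + 1)" by (rule sum_mono) (rule card_residue_class_le)
  finally show ?thesis by simp
qed

text \<open>By the choice of \<open>k\<close>, \<open>2 ^ k\<close> is at least
  \<open>r ^ (s + 1)\<close>. This pays for the at most \<open>r ^ s\<close> colour sets and for the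
  factor \<open>9 * N\<close>, since \<open>9 * N * s <= r\<close> leaves a gain of one half per
  edge.\<close>

lemma counting_bound:
  assumes "r \<ge> 2" "s \<ge> 1" "s \<le> r" and N: "9 * s * N \<le> r" and k: "(real s + 1) * log 2 r \<le> k"
  shows "(r choose s) * (N choose Suc k) * ((Suc k choose 2) choose k) * s ^ k < r ^ k"
proof -
  define p where "p = real (r choose s)"
  define q where "q = real (N choose Suc k) * real ((Suc k choose 2) choose k)"
  have "log 2 r \<ge> 1" using assms(1) by simp
  then have "(real s + 1) * log 2 r \<ge> 1 * 1" by (intro mult_mono) auto
  with k have "k \<ge> 1" by linarith
  have p: "p \<le> real r ^ s" unfolding p_def
    using binomial_le_pow[OF \<open>s \<le> r\<close>] by (simp flip: of_nat_power)
  have "real r ^ Suc s = (2 powr log 2 r) powr real (Suc s)"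
    using assms(1) by (simp add: powr_realpow del: of_nat_Suc power_Suc)
  also have "\<dots> = 2 powr ((real s + 1) * log 2 r)" by (simp add: powr_powr mult.commute add.commute)
  also have "\<dots> \<le> 2 powr k" using k by (intro powr_mono) auto
  finally have rs: "real r ^ s * r \<le> 2 ^ k" by (simp add: powr_realpow mult.commute)
  have N': "9 * real N * s \<le> r" using N by (metis (no_types, opaque_lifting) mult.assoc mult.commute of_nat_le_iff of_nat_mult of_nat_numeral)
  moreover have "9 * real N * 1 \<le> 9 * real N * s" using \<open>s \<ge> 1\<close> by (intro mult_left_mono) auto
  ultimately have N'': "9 * real N \<le> r" by linarith
  have "q * Suc k * s ^ k \<le> 9 * real N * (9 * real N / 2) ^ k * s ^ k"
    unfolding q_def by (rule mult_right_mono[OF binomial_product_le]) simp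
  also have "\<dots> = 9 * N * (9 * real N * s / 2) ^ k" by (simp add: power_mult_distrib power_divide)
  also have "\<dots> \<le> r * (r / 2) ^ k" using N' N'' by (intro mult_mono power_mono) auto
  finally have q: "q * Suc k * s ^ k \<le> r * (r / 2) ^ k" .
  have "p * (q * Suc k * s ^ k) \<le> real r ^ s * (r * (r / 2) ^ k)"
    by (rule mult_mono[OF p q]) (auto simp: q_def)
  also have "\<dots> = (real r ^ s * r) * (r / 2) ^ k" by simp
  also have "\<dots> \<le> 2 ^ k * (r / 2) ^ k" using rs by (intro mult_right_mono) auto
  also have "\<dots> = real r ^ k" by (simp add: power_divide)
  finally have "p * q * s ^ k * Suc k \<le> real r ^ k" by (simp only: mult_ac)
  moreover have "0 < real r ^ k" using assms(1) by simp
  \<comment> \<open>Since \<open>k >= 1\<close>, the spare factor is at least 2 and turns the weak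
    inequality into a strict one.\<close>
  moreover have "p * q * s ^ k * 2 \<le> p * q * s ^ k * Suc k"
    using \<open>k \<ge> 1\<close> by (intro mult_left_mono) (auto simp: p_def q_def)
  ultimately have "p * q * s ^ k < real r ^ k" by linarith
  then have "real ((r choose s) * (N choose Suc k) * ((Suc k choose 2) choose k) * s ^ k) < real (r ^ k)"
    by (simp add: p_def q_def mult.assoc)
  then show ?thesis by (simp only: of_nat_less_iff)
qed

subsection \<open>Bounds on the connected number\<close>

lemma connected_number_le:
  assumes "n \<ge> 1" "r \<ge> 1" "edge_colouring n r \<chi>"
    and "\<And>S v. S \<subseteq> {..<r} \<Longrightarrow> card S \<le> s \<Longrightarrow> v < n \<Longrightarrow> card (component n \<chi> S v) \<le> m"
  shows "connected_number n r s \<le> m"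
proof -
  obtain S H where SH: "S \<subseteq> {..<r}" "card S \<le> s" "connected_in_colours n \<chi> S H"
    "connected_number n r s \<le> card (verts H)"
    using connected_number_ge_iff[OF assms(1,2), of "connected_number n r s" s] assms(3) by blast
  then have "verts H \<noteq> {}" and sub: "verts H \<subseteq> {..<n}"
    by (auto simp: connected_in_colours_def Digraph_Component.connected_def strongly_connected_def
        subgraph_def complete_graph_def)
  then obtain v where v: "v \<in> verts H" "v < n" by blast
  have "card (verts H) \<le> card (component n \<chi> S v)"
    by (rule card_mono[OF finite_component[OF v(2)] verts_subset_component[OF SH(3) v(1)]])
  with SH assms(4)[OF SH(1,2) v(2)] show ?thesis by linarith
qed

lemma connected_number_ge:
  fixes x :: real
  assumes "n \<ge> 1" "r \<ge> 1"
    and large: "\<And>\<chi>. edge_colouring n r \<chi> \<Longrightarrow>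
      \<exists>S u. S \<subseteq> {..<r} \<and> card S \<le> s \<and> u < n \<and> x \<le> card (component n \<chi> S u)"
  shows "x \<le> connected_number n r s"
proof -
  \<comment> \<open>Rounding up loses nothing, as component sizes are integers.\<close>
  have "nat \<lceil>x\<rceil> \<le> connected_number n r s"
    unfolding connected_number_ge_iff[OF assms(1,2)]
  proof (intro allI impI)
    fix \<chi> assume "edge_colouring n r \<chi>"
    from large[OF this] obtain S u where S: "S \<subseteq> {..<r}" "card S \<le> s" "u < n"
      "x \<le> card (component n \<chi> S u)" by blast
    obtain H where "connected_in_colours n \<chi> S H" "verts H = component n \<chi> S u"
      by (rule connected_in_colours_component[OF S(3)])
    moreover have "nat \<lceil>x\<rceil> \<le> card (component n \<chi> S u)" using S(4) by (simp add: nat_le_iff ceiling_le_iff)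
    ultimately show "\<exists>S H. S \<subseteq> {..<r} \<and> card S \<le> s \<and> connected_in_colours n \<chi> S H \<and>
        nat \<lceil>x\<rceil> \<le> card (verts H)" using S by (intro exI[of _ S] exI[of _ H]) simp
  qed
  then show ?thesis by linarith
qed

lemma connected_number_lower_bound:
  assumes "s \<ge> 1" "s\<^sup>2 \<le> r" "n \<ge> 4"
  shows "(real s)\<^sup>2 / r * n / 300 \<le> connected_number n r s"
proof (rule connected_number_ge)
  have "0 < s\<^sup>2" using assms(1) by simp
  with assms(2) show r: "r \<ge> 1" by linarith
  show "n \<ge> 1" using assms by simp
  fix \<chi> assume col: "edge_colouring n r \<chi>"
  show "\<exists>S u. S \<subseteq> {..<r} \<and> card S \<le> s \<and> u < n \<and> (real s)\<^sup>2 / r * n / 300 \<le> card (component n \<chi> S u)"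
  \<comment> \<open>For \<open>s = 1\<close> half of the colour budget rounds down to zero, so the
    greedy argument is replaced by the pigeonhole bound.\<close>
  proof (cases "s = 1")
    case True
    obtain i where i: "i < r" "real n / r \<le> card (component n \<chi> {i} 0)"
      using large_component_one_colour[OF col r] assms(3) by auto
    have "real n / r / 300 \<le> real n / r" using r by (simp add: field_simps)
    with i have "(real s)\<^sup>2 / r * n / 300 \<le> card (component n \<chi> {i} 0)" using True by simp
    then show ?thesis using True i assms(3) by (intro exI[of _ "{i}"] exI[of _ 0]) simp
  next
    case False
    then show ?thesis using large_component[OF col _ assms(2,3)] assms(1) by simp
  qed
qed

lemma small_components_colouring:
  assumes "r \<ge> 2" "s \<ge> 1" "s \<le> r" and N: "N \<ge> 1" "9 * s * N \<le> r"
    and k: "(real s + 1) * log 2 r \<le> k"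
  shows "\<exists>\<chi>. (\<forall>e. e \<subseteq> {..<N} \<and> card e = 2 \<longrightarrow> \<chi> e < r) \<and>
    (\<forall>S v. S \<subseteq> {..<r} \<and> card S \<le> s \<and> v < N \<longrightarrow> card (component N \<chi> S v) \<le> k)"
proof -
  obtain \<chi> where \<chi>: "\<And>e. e \<subseteq> {..<N} \<Longrightarrow> card e = 2 \<Longrightarrow> \<chi> e < r"
    and no_tree: "\<And>S A F. S \<subseteq> {..<r} \<Longrightarrow> card S = s \<Longrightarrow> A \<subseteq> {..<N} \<Longrightarrow> card A = Suc k \<Longrightarrow>
      F \<subseteq> {e. e \<subseteq> A \<and> card e = 2} \<Longrightarrow> card F = k \<Longrightarrow> \<exists>e\<in>F. \<chi> e \<notin> S"
    using colouring_by_counting[OF counting_bound[OF assms(1-3) N(2) k] assms(3)] assms(1) by auto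
  have "card (component N \<chi> S v) \<le> k" if S: "S \<subseteq> {..<r}" "card S \<le> s" and v: "v < N" for S v
  proof (rule ccontr)
    assume "\<not> ?thesis"
    \<comment> \<open>The union bound treats colour sets of size exactly \<open>s\<close>; smaller
      sets are enlarged, which only enlarges components.\<close>
    moreover obtain S' where S': "S \<subseteq> S'" "S' \<subseteq> {..<r}" "card S' = s"
      using exists_subset_between[of S s "{..<r}"] S assms(3) by auto
    moreover have "card (component N \<chi> S v) \<le> card (component N \<chi> S' v)"
      by (rule card_mono[OF finite_component[OF v] component_mono[OF S'(1)]])
    ultimately have "k < card (component N \<chi> S' v)" by linarith
    from component_contains_tree[OF v this] obtain A F where tree:
      "A \<subseteq> component N \<chi> S' v" "card A = Suc k" "F \<subseteq> {e. e \<subseteq> A \<and> card e = 2}" "card F = k"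
      "\<forall>e\<in>F. \<chi> e \<in> S'" by blast
    then show False
      using no_tree[OF S'(2,3) subset_trans[OF tree(1) component_subset[OF v]] tree(2-4)] by blast
  qed
  with \<chi> show ?thesis by (intro exI[of _ \<chi>]) blast
qed

lemma connected_number_upper_bound:
  assumes "r \<ge> 2" "s \<ge> 1" "s \<le> r" "n \<ge> r"
  shows "connected_number n r s \<le> 108 * ((real s)\<^sup>2 / r) * log 2 r * n"
proof -
  have log: "log 2 r \<ge> 1" and n: "n \<ge> 1" and r: "r \<ge> 1" using assms by auto
  have s1: "real s \<ge> 1" using assms by simp
  show ?thesis
  proof (cases "9 * s \<le> r")
    \<comment> \<open>Here \<open>r < 9 * s\<close>, so the claimed bound already exceeds
      \<open>n\<close>.\<close>
    case False
    have "connected_number n r s \<le> n"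
      using n r
    proof (rule connected_number_le)
      show "edge_colouring n r (\<lambda>_. 0)" using r by (simp add: edge_colouring_iff)
      show "card (component n (\<lambda>_. 0) S v) \<le> n" if "v < n" for S v
        using card_mono[OF _ component_subset[OF that]] by fastforce
    qed
    moreover have "1 \<le> 108 * ((real s)\<^sup>2 / r)"
    proof -
      have "real r \<le> 9 * real s * 1" using False by simp
      also have "\<dots> \<le> 9 * real s * s" using s1 by (intro mult_left_mono) auto
      finally show ?thesis using r by (simp add: field_simps power2_eq_square)
    qed
    then have "1 * 1 * real n \<le> 108 * ((real s)\<^sup>2 / r) * log 2 r * n"
      using log by (intro mult_right_mono mult_mono) auto
    ultimately show ?thesis by linarith
  next
    case True
    define N where "N = r div (9 * s)"
    define k where "k = nat \<lceil>(real s + 1) * log 2 r\<rceil>"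
    have N: "N \<ge> 1" "9 * s * N \<le> r" "N \<le> n"
      using True assms(2) le_trans[OF div_le_dividend assms(4)]
      by (simp_all add: N_def Suc_le_eq div_greater_zero_iff)
    \<comment> \<open>Since \<open>N >= 1\<close>, rounding down in \<open>N\<close> costs at most a
      factor 2.\<close>
    have "r < 9 * s * N + 9 * s" using assms(2) dividend_less_div_times[of "9 * s" r]
      by (simp add: N_def mult.commute add.commute)
    also have "\<dots> \<le> 9 * s * N + 9 * s * N" using N(1) by simp
    finally have "r \<le> 18 * s * N" by (simp add: mult_ac)
    then have "real r \<le> real (18 * s * N)" by (simp only: of_nat_le_iff)
    then have "real r \<le> 18 * s * real N" by simp
    then have N_inv: "1 / real N \<le> 18 * real s / r" using N(1) r by (simp add: field_simps)
    have "1 \<le> s * log 2 r" using mult_mono[OF s1 log] by simp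
    moreover have "log 2 r \<le> s * log 2 r" using mult_right_mono[OF s1, of "log 2 r"] log by simp
    moreover have k: "(real s + 1) * log 2 r \<le> k"
      unfolding k_def by (rule real_nat_ceiling_ge)
    moreover have "real k \<le> (real s + 1) * log 2 r + 1"
      using of_int_ceiling_le_add_one[of "(real s + 1) * log 2 r"] log by (simp add: k_def)
    ultimately have k3: "k \<le> 3 * (s * log 2 r)" by (simp add: distrib_right)
    obtain \<chi> where \<chi>: "\<forall>e. e \<subseteq> {..<N} \<and> card e = 2 \<longrightarrow> \<chi> e < r"
      and small: "\<forall>S v. S \<subseteq> {..<r} \<and> card S \<le> s \<and> v < N \<longrightarrow> card (component N \<chi> S v) \<le> k"
      using small_components_colouring[OF assms(1-3) N(1,2) k] by (elim exE conjE)
    have "edge_colouring n r (blow_up N \<chi>)"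
      using \<chi> N(1) r by (intro edge_colouring_blow_up) simp_all
    with n r have "connected_number n r s \<le> k * (n div N + 1)"
    proof (rule connected_number_le)
      fix S v assume S: "S \<subseteq> {..<r}" "card S \<le> s" and v: "v < n"
      have "card (component n (blow_up N \<chi>) S v) \<le> card (component N \<chi> S (v mod N)) * (n div N + 1)"
        by (rule card_component_blow_up[OF v N(1)])
      also have "\<dots> \<le> k * (n div N + 1)"
        using small S N(1) by (intro mult_right_mono) simp_all
      finally show "card (component n (blow_up N \<chi>) S v) \<le> k * (n div N + 1)" .
    qed
    then have "real (connected_number n r s) \<le> real (k * (n div N + 1))"
      by (simp only: of_nat_le_iff)
    also have "\<dots> = real k * real (n div N + 1)" by (rule of_nat_mult)
    \<comment> \<open>The constant is \<open>108 = 3 * 2 * 18\<close>: 3 from rounding up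
      \<open>k\<close>, 2 from class sizes because \<open>N <= n\<close>, and 18 from
      \<open>N_inv\<close>.\<close>
    also have "\<dots> \<le> 3 * (s * log 2 r) * (2 * real n * (18 * real s / r))"
    proof (rule mult_mono[OF k3])
      have "real (n div N + 1) \<le> n / N + 1" using of_nat_div_le_of_nat[of n N] by simp
      also have "\<dots> \<le> 2 * real n * (1 / N)" using N by (simp add: field_simps)
      also have "\<dots> \<le> 2 * real n * (18 * real s / r)" using N_inv by (intro mult_left_mono) auto
      finally show "real (n div N + 1) \<le> 2 * real n * (18 * real s / r)" .
    qed (use log in auto)
    also have "\<dots> = 108 * ((real s)\<^sup>2 / r) * log 2 r * n" by (simp add: power2_eq_square)
    finally show ?thesis .
  qed
qed

theorem theorem1p2:
  shows "\<exists>c C :: real. c > 0 \<and> C > 0 \<and>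
    (\<forall>r s :: nat. r \<ge> 2 \<and> 1 \<le> s \<and> real s \<le> sqrt (real r) \<longrightarrow>
      (\<exists>n\<^sub>0 :: nat. \<forall>n \<ge> n\<^sub>0.
         c * ((real s)\<^sup>2 / real r) * real n \<le> real (connected_number n r s) \<and>
         real (connected_number n r s) \<le> C * ((real s)\<^sup>2 / real r) * log 2 (real r) * real n))"
proof (rule exI[of _ "1 / 300"], rule exI[of _ 108], intro conjI allI impI)
  fix r s :: nat assume rs: "r \<ge> 2 \<and> 1 \<le> s \<and> real s \<le> sqrt (real r)"
  then have "(real s)\<^sup>2 \<le> (sqrt r)\<^sup>2" by (intro power_mono) auto
  then have "real (s\<^sup>2) \<le> real r" by simp
  then have s2: "s\<^sup>2 \<le> r" by (simp only: of_nat_le_iff)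
  then have sr: "s \<le> r" using rs by (auto simp: power2_eq_square intro: order_trans[rotated])
  show "\<exists>n\<^sub>0 :: nat. \<forall>n \<ge> n\<^sub>0.
      1 / 300 * ((real s)\<^sup>2 / real r) * real n \<le> real (connected_number n r s) \<and>
      real (connected_number n r s) \<le> 108 * ((real s)\<^sup>2 / real r) * log 2 (real r) * real n"
  \<comment> \<open>The lower bound asks for \<open>n >= 4\<close>; the upper bound asks for
    \<open>n >= r\<close>, so that the blow-up has \<open>N <= n\<close>.\<close>
  proof (intro exI[of _ "max 4 r"] allI impI conjI)
    fix n assume n: "max 4 r \<le> n"
    show "1 / 300 * ((real s)\<^sup>2 / real r) * real n \<le> real (connected_number n r s)"
      using connected_number_lower_bound[of s r n] rs s2 n by simp
    show "real (connected_number n r s) \<le> 108 * ((real s)\<^sup>2 / real r) * log 2 (real r) * real n"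
      using connected_number_upper_bound[of r s n] rs sr n by simp
  qed
qed auto

end
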